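(* Let $n\ge 1$ and let $A$ be an $n\times n$ Markov matrix. Then $A$ has at least one eigenvector $\boldsymbol{\alpha}=(\alpha_1,\dots,\alpha_n)^T$ whose components are all nonnegative and the sum of whose components is positive. (Consequently the normalized vector $\boldsymbol{\xi}=\boldsymbol{\alpha}/\sum_{i=1}^n\alpha_i$ lies in $S2_n$.)
   Context: A real $n\times n$ matrix $A=(a_{ij})$ is called a Markov matrix if $a_{ij}\ge 0$ for all $1\le i,j\le n$ and $\sum_{i=1}^n a_{ij}=1$ for every $1\le j\le n$ (each column sums to $1$). It acts on column vectors by $X\mapsto AX$. Notation: $S2_n=\{X=(x_1,\dots,x_n)^T\in\mathbb{R}^n : \sum_{i=1}^n x_i=1,\ x_i\ge 0 \text{ for all } 1\le i\le n\}$. *)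

theory Defs
  imports "Jordan_Normal_Form.Char_Poly"
begin

text \<open>Matrix and vector indices range over \<open>{0..<n}\<close>, as usual for these matrices, rather than over \<open>{1..n}\<close>.\<close>

text \<open>Column-stochastic convention: each column sums to 1, so \<open>A\<close> acts on column vectors from the left.\<close>

definition markov_matrix :: "nat \<Rightarrow> real mat \<Rightarrow> bool" where
  "markov_matrix n A \<longleftrightarrow>
     A \<in> carrier_mat n n \<and>
     (\<forall>i<n. \<forall>j<n. A $$ (i, j) \<ge> 0) \<and>
     (\<forall>j<n. (\<Sum>i<n. A $$ (i, j)) = 1)"

definition S2 :: "nat \<Rightarrow> real vec set" where
  "S2 n = {X \<in> carrier_vec n. (\<Sum>i<n. X $ i) = 1 \<and> (\<forall>i<n. X $ i \<ge> 0)}"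

end

theory Submission
  imports Defs
begin

text \<open>The all-ones vector is fixed by the transpose of \<open>A\<close>, so 1 is an eigenvalue of \<open>A\<close>, say
  \<open>A v = v\<close>. The triangle inequality gives \<open>\<bar>v\<bar> \<le> A \<bar>v\<bar>\<close> entrywise, and both sides have the same
  coordinate sum because the columns of \<open>A\<close> sum to 1; hence \<open>A \<bar>v\<bar> = \<bar>v\<bar>\<close>.\<close>

text \<open>Exchanging the two sums isolates the column sums, each equal to 1. Taking
  \<open>x\<close> as a plain function lets it be instantiated with \<open>\<bar>v $ j\<bar>\<close>
  directly.\<close>

lemma markov_matrix_sum_mult:
  assumes "markov_matrix n A"
  shows "(\<Sum>i<n. \<Sum>j<n. A $$ (i, j) * x j) = (\<Sum>j<n. x j)"
proof -
  have "(\<Sum>i<n. \<Sum>j<n. A $$ (i, j) * x j) = (\<Sum>j<n. (\<Sum>i<n. A $$ (i, j)) * x j)"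
    by (subst sum.swap) (simp add: sum_distrib_right)
  also have "\<dots> = (\<Sum>j<n. x j)"
    using assms by (simp add: markov_matrix_def)
  finally show ?thesis .
qed

lemma mult_mat_vec_index_sum:
  assumes "A \<in> carrier_mat m n" and "v \<in> carrier_vec n" and "i < m"
  shows "(A *\<^sub>v v) $ i = (\<Sum>j<n. A $$ (i, j) * v $ j)"
  using assms by (auto simp: scalar_prod_def atLeast0LessThan intro!: sum.cong)

lemma markov_matrix_eigenvalue_1:
  assumes "n \<ge> 1" and "markov_matrix n A"
  shows "eigenvalue A 1"
proof -
  have A: "A \<in> carrier_mat n n"
    using assms(2) by (simp add: markov_matrix_def)
  define u :: "real vec" where "u = vec n (\<lambda>_. 1)"
  have u: "u \<in> carrier_vec n"
    by (simp add: u_def)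
  have "transpose_mat A *\<^sub>v u = u"
  proof (rule eq_vecI)
    fix j assume "j < dim_vec u"
    then have j: "j < n" by (simp add: u_def)
    have "(transpose_mat A *\<^sub>v u) $ j = (\<Sum>i<n. transpose_mat A $$ (j, i) * u $ i)"
      using A u j by (intro mult_mat_vec_index_sum) auto
    also have "\<dots> = (\<Sum>i<n. A $$ (i, j))"
      using A j by (intro sum.cong) (auto simp: u_def)
    also have "\<dots> = u $ j"
      using assms(2) j by (simp add: markov_matrix_def u_def)
    finally show "(transpose_mat A *\<^sub>v u) $ j = u $ j" .
  qed (use A u in auto)
  moreover have "u \<noteq> 0\<^sub>v n"
  proof
    assume "u = 0\<^sub>v n"
    \<comment> \<open>Index 0 is in range because \<open>n \<ge> 1\<close>; in dimension 0 the
      all-ones vector would be the zero vector.\<close>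
    then have "u $ 0 = 0\<^sub>v n $ 0" by simp
    with assms(1) show False by (simp add: u_def)
  qed
  ultimately have "eigenvector (transpose_mat A) u 1"
    using A u by (auto simp: eigenvector_def)
  then have "eigenvalue (transpose_mat A) 1"
    by (auto simp: eigenvalue_def)
  \<comment> \<open>\<open>A\<close> and its transpose share a characteristic polynomial, hence
    their eigenvalues. The eigenvector \<open>u\<close> does not carry over, so nothing is known yet
    about the signs of an eigenvector of \<open>A\<close>.\<close>
  then show ?thesis
    using A by (simp add: eigenvalue_root_char_poly[where n = n])
qed

lemma markov_matrix_abs_fixed_vec:
  assumes "markov_matrix n A" and v: "v \<in> carrier_vec n" and fixed: "A *\<^sub>v v = v"
  shows "A *\<^sub>v map_vec abs v = map_vec abs v"
proof -
  have A: "A \<in> carrier_mat n n" and nonneg: "\<And>i j. i < n \<Longrightarrow> j < n \<Longrightarrow> A $$ (i, j) \<ge> 0"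
    using assms(1) by (auto simp: markov_matrix_def)
  define w where "w i = (\<Sum>j<n. A $$ (i, j) * \<bar>v $ j\<bar>)" for i
  have le: "\<bar>v $ i\<bar> \<le> w i" if "i < n" for i
  proof -
    have "\<bar>v $ i\<bar> = \<bar>\<Sum>j<n. A $$ (i, j) * v $ j\<bar>"
      using mult_mat_vec_index_sum[OF A v that] fixed by simp
    also have "\<dots> \<le> (\<Sum>j<n. \<bar>A $$ (i, j) * v $ j\<bar>)"
      by (rule sum_abs)
    \<comment> \<open>Since the entries of \<open>A\<close> are nonnegative, the absolute value
      falls on \<open>v $ j\<close> alone.\<close>
    also have "\<dots> = w i"
      using nonneg that by (simp add: w_def abs_mult)
    finally show ?thesis .
  qed
  \<comment> \<open>The gaps \<open>w i - \<bar>v $ i\<bar>\<close> are nonnegative by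
    \<open>le\<close>; as their total is 0, each of them vanishes.\<close>
  have "(\<Sum>i<n. w i - \<bar>v $ i\<bar>) = 0"
    using markov_matrix_sum_mult[OF assms(1)] by (simp add: w_def sum_subtractf)
  then have eq: "w i = \<bar>v $ i\<bar>" if "i < n" for i
    using le that by (subst (asm) sum_nonneg_eq_0_iff) auto
  show ?thesis
  proof (rule eq_vecI)
    fix i assume "i < dim_vec (map_vec abs v)"
    then have i: "i < n" using v by simp
    have "(A *\<^sub>v map_vec abs v) $ i = (\<Sum>j<n. A $$ (i, j) * map_vec abs v $ j)"
      using A v i by (intro mult_mat_vec_index_sum) auto
    also have "\<dots> = w i"
      using v by (simp add: w_def)
    finally show "(A *\<^sub>v map_vec abs v) $ i = map_vec abs v $ i"
      using eq[OF i] v i by simp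
  qed (use A v in auto)
qed

theorem theorem3:
  fixes n :: nat and A :: "real mat"
  assumes "n \<ge> 1" and "markov_matrix n A"
  shows "\<exists>\<alpha> \<mu>. eigenvector A \<alpha> \<mu> \<and>
           (\<forall>i<n. \<alpha> $ i \<ge> 0) \<and> (\<Sum>i<n. \<alpha> $ i) > 0 \<and>
           (1 / (\<Sum>i<n. \<alpha> $ i)) \<cdot>\<^sub>v \<alpha> \<in> S2 n"
proof -
  have A: "A \<in> carrier_mat n n"
    using assms(2) by (simp add: markov_matrix_def)
  obtain v where v: "v \<in> carrier_vec n" "v \<noteq> 0\<^sub>v n" "A *\<^sub>v v = v"
    using markov_matrix_eigenvalue_1[OF assms] A by (auto simp: eigenvalue_def eigenvector_def)
  define \<alpha> where "\<alpha> = map_vec abs v"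
  define s where "s = (\<Sum>i<n. \<alpha> $ i)"
  have carrier: "\<alpha> \<in> carrier_vec n" and nonneg: "\<And>i. i < n \<Longrightarrow> \<alpha> $ i \<ge> 0"
    using v(1) by (auto simp: \<alpha>_def)
  \<comment> \<open>One nonzero coordinate of \<open>v\<close> serves twice: it makes the sum
    \<open>s\<close> positive and \<open>\<alpha>\<close> nonzero.\<close>
  obtain k where k: "k < n" "v $ k \<noteq> 0"
    using v(1,2) by (metis carrier_vecD eq_vecI index_zero_vec)
  then have "\<alpha> $ k > 0"
    using v(1) by (simp add: \<alpha>_def)
  then have pos: "s > 0"
    unfolding s_def using k(1) nonneg by (intro sum_pos2[where i = k]) auto
  have "\<alpha> \<noteq> 0\<^sub>v n"
    using \<open>\<alpha> $ k > 0\<close> k(1) by auto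
  then have "eigenvector A \<alpha> 1"
    using A carrier markov_matrix_abs_fixed_vec[OF assms(2) v(1,3)]
    by (auto simp: eigenvector_def \<alpha>_def)
  \<comment> \<open>Pulling the common denominator out of the coordinate sum leaves
    \<open>s / s\<close>, which is 1 because \<open>s > 0\<close>.\<close>
  moreover have "(1 / s) \<cdot>\<^sub>v \<alpha> \<in> S2 n"
    using carrier nonneg pos by (simp add: S2_def s_def flip: sum_divide_distrib)
  ultimately show ?thesis
    using nonneg pos unfolding s_def by blast
qed

end
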